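(* Let $(u_h,r_h)\in X_{\tau,h}\times Y_{\tau,h}$ be a solution of the SAV--Gauss collocation finite element method, that is, $u_h(0)=I_hu_0$, $r_h(0)=r_0$, and for all $n=1,\dots,N$, $j=1,\dots,k$, $$\mathrm{i}\bigl(\partial_t u_h(t_{nj}),v_h\bigr)+\bigl(\nabla u_h(t_{nj}),\nabla v_h\bigr)-\bigl(r_h(t_{nj})\,g(u_h(t_{nj}))\,u_h(t_{nj}),v_h\bigr)=0\qquad\forall\,v_h\in S_h,$$ $$\partial_t r_h(t_{nj})=\tfrac12\,\mathrm{Re}\bigl(g(u_h(t_{nj}))u_h(t_{nj}),\partial_t u_h(t_{nj})\bigr),$$ where $\partial_t$ at $t_{nj}$ denotes the time derivative of the polynomial restricted to $I_n$. Then for all $1\le n\le N$, $$\tfrac12\|u_h(t_n)\|^2=\tfrac12\|u_h(t_0)\|^2,$$ $$\tfrac12\|\nabla u_h(t_n)\|^2-|r_h(t_n)|^2+c_0=\tfrac12\|\nabla u_h(t_0)\|^2-|r_h(t_0)|^2+c_0 .$$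
   Context: $\Omega\subset\mathbb{R}^d$ is a (bounded) polygonal or polyhedral domain; $(u,v)=\int_\Omega u\,\overline v\,dx$ and $\|\cdot\|$ are the inner product and norm of the complex-valued space $L^2(\Omega)$. The underlying problem is the nonlinear Schrödinger equation $\mathrm{i}\partial_tu-\Delta u-f(|u|^2)u=0$ in $\Omega\times(0,T]$, $u=0$ on $\partial\Omega\times(0,T]$, $u(0)=u_0$, where $f:\mathbb{R}_+\to\mathbb{R}$ is the derivative of $F:\mathbb{R}_+\to\mathbb{R}$. SAV formulation: with a constant $c_0>0$, $$g(v)=\frac{f(|v|^2)}{\sqrt{\int_\Omega\frac12F(|v|^2)\,dx+c_0}},\qquad r_0=\sqrt{\int_\Omega\tfrac12F(|u_0|^2)\,dx+c_0},$$ where $c_0$ is such that the quantities under the square roots are positive wherever $g$ is evaluated. Discretization: $\mathcal T_h$ is a shape-regular, quasi-uniform triangulation of $\Omega$ with mesh size $h\in(0,1)$; $p\ge1$; $S_h$ is the space of complex-valued continuous functions on $\overline\Omega$ vanishing on $\partial\Omega$ whose restriction to each $K\in\mathcal T_h$ is a polynomial of degree $\le p$; $I_h$ is the Lagrange interpolation operator onto $S_h$. $t_n=n\tau$, $n=0,\dots,N$, $\tau=T/N\in(0,1)$, $I_n=[t_{n-1},t_n]$. $k\ge1$; $c_j$, $j=1,\dots,k$, are the nodes of the $k$-point Gauss quadrature on $[-1,1]$ and $t_{nj}=t_{n-1}+(1+c_j)\tau/2$. $\mathbb{P}^k$ is the space of real polynomials in $t$ of degree $\le k$, and $\mathbb{P}^k\otimes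 X=\{\sum_{j=0}^kt^j\phi_j:\phi_j\in X\}$. $X_{\tau,h}=\{v_h\in C([0,T];S_h):v_h|_{I_n}\in\mathbb{P}^k\otimes S_h,\ n=1,\dots,N\}$, $Y_{\tau,h}=\{q_h\in C([0,T]):q_h|_{I_n}\in\mathbb{P}^k,\ n=1,\dots,N\}$. *)

theory Defs
  imports "HOL-Analysis.Analysis" "HOL-Computational_Algebra.Polynomial"
begin

definition L2_inner :: "'a::euclidean_space set \<Rightarrow> ('a \<Rightarrow> complex) \<Rightarrow> ('a \<Rightarrow> complex) \<Rightarrow> complex" where
  "L2_inner \<Omega> u v = (LINT x:\<Omega>|lebesgue. u x * cnj (v x))"

definition L2_norm :: "'a::euclidean_space set \<Rightarrow> ('a \<Rightarrow> complex) \<Rightarrow> real" where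
  "L2_norm \<Omega> v = sqrt (Re (L2_inner \<Omega> v v))"

definition partial_deriv :: "'a::euclidean_space \<Rightarrow> ('a \<Rightarrow> complex) \<Rightarrow> 'a \<Rightarrow> complex" where
  "partial_deriv b u x = frechet_derivative u (at x) b"

text \<open>The inner product of two gradients. A finite element function need not be differentiable on
  the boundaries of the mesh cells; as these form a null set and \<^const>\<open>lebesgue\<close> is complete, the
  unspecified values of the derivative there do not affect the integral, which is the one
  formed with the weak gradients.\<close>

definition grad_inner :: "'a::euclidean_space set \<Rightarrow> ('a \<Rightarrow> complex) \<Rightarrow> ('a \<Rightarrow> complex) \<Rightarrow> complex" where
  "grad_inner \<Omega> u v = (\<Sum>b\<in>Basis. L2_inner \<Omega> (partial_deriv b u) (partial_deriv b v))"

definition grad_norm :: "'a::euclidean_space set \<Rightarrow> ('a \<Rightarrow> complex) \<Rightarrow> real" where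
  "grad_norm \<Omega> v = sqrt (Re (grad_inner \<Omega> v v))"

definition polyhedral_domain :: "'a::euclidean_space set \<Rightarrow> bool" where
  "polyhedral_domain \<Omega> \<longleftrightarrow>
     open \<Omega> \<and> connected \<Omega> \<and> \<Omega> \<noteq> {} \<and> bounded \<Omega> \<and>
     (\<exists>\<F>. finite \<F> \<and> (\<forall>P\<in>\<F>. polytope P \<and> aff_dim P = int DIM('a) - 1) \<and> frontier \<Omega> = \<Union>\<F>)"

text \<open>The condition on \<^term>\<open>frontier \<Omega>\<close> says that the mesh resolves the boundary. It is automatic
  if \<^term>\<open>\<Omega>\<close> lies on one side of its boundary, and matters only for domains with slits.\<close>

definition domain_triangulation :: "'a::euclidean_space set \<Rightarrow> 'a set set \<Rightarrow> bool" where
  "domain_triangulation \<Omega> \<T> \<longleftrightarrow>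
     triangulation \<T> \<and> (\<forall>K\<in>\<T>. int DIM('a) simplex K) \<and> \<Union>\<T> = closure \<Omega> \<and>
     (\<exists>\<F>. (\<forall>F\<in>\<F>. \<exists>K\<in>\<T>. F face_of K) \<and> frontier \<Omega> = \<Union>\<F>)"

definition mesh_size :: "'a::euclidean_space set set \<Rightarrow> real" where
  "mesh_size \<T> = Max (diameter ` \<T>)"

definition inball_diameter :: "'a::euclidean_space set \<Rightarrow> real" where
  "inball_diameter K = Sup {2 * r |r x. 0 < r \<and> cball x r \<subseteq> K}"

definition shape_regular :: "real \<Rightarrow> 'a::euclidean_space set set \<Rightarrow> bool" where
  "shape_regular \<sigma> \<T> \<longleftrightarrow> (\<forall>K\<in>\<T>. diameter K \<le> \<sigma> * inball_diameter K)"

definition quasi_uniform :: "real \<Rightarrow> 'a::euclidean_space set set \<Rightarrow> bool" where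
  "quasi_uniform \<kappa> \<T> \<longleftrightarrow> (\<forall>K\<in>\<T>. mesh_size \<T> \<le> \<kappa> * diameter K)"

definition multi_indices :: "nat \<Rightarrow> ('a::euclidean_space \<Rightarrow> nat) set" where
  "multi_indices p = {\<alpha>. (\<forall>b. b \<notin> Basis \<longrightarrow> \<alpha> b = 0) \<and> (\<Sum>b\<in>Basis. \<alpha> b) \<le> p}"

definition polynomial_on :: "nat \<Rightarrow> 'a::euclidean_space set \<Rightarrow> ('a \<Rightarrow> complex) \<Rightarrow> bool" where
  "polynomial_on p K v \<longleftrightarrow>
     (\<exists>c. \<forall>x\<in>K. v x = (\<Sum>\<alpha>\<in>multi_indices p. c \<alpha> * of_real (\<Prod>b\<in>Basis. (x \<bullet> b) ^ \<alpha> b)))"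

text \<open>Functions on the closure of \<^term>\<open>\<Omega>\<close> that vanish on its boundary are represented by their
  extension by zero to the whole space.\<close>

definition fe_space :: "'a::euclidean_space set \<Rightarrow> 'a set set \<Rightarrow> nat \<Rightarrow> ('a \<Rightarrow> complex) set" where
  "fe_space \<Omega> \<T> p =
     {v. continuous_on (closure \<Omega>) v \<and> (\<forall>x. x \<notin> \<Omega> \<longrightarrow> v x = 0) \<and> (\<forall>K\<in>\<T>. polynomial_on p K v)}"

text \<open>The points of the simplex \<^term>\<open>K\<close> whose barycentric coordinates are multiples of \<open>1/p\<close>.\<close>

definition lagrange_nodes :: "nat \<Rightarrow> 'a::euclidean_space set \<Rightarrow> 'a set" where
  "lagrange_nodes p K =
     {\<Sum>a | a extreme_point_of K. (real (m a) / real p) *\<^sub>R a |m.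
        (\<Sum>a | a extreme_point_of K. m a) = p}"

text \<open>The nodes outside \<^term>\<open>\<Omega>\<close> lie on its boundary, where all elements of \<^const>\<open>fe_space\<close>
  vanish.\<close>

definition lagrange_interp ::
  "'a::euclidean_space set \<Rightarrow> 'a set set \<Rightarrow> nat \<Rightarrow> ('a \<Rightarrow> complex) \<Rightarrow> 'a \<Rightarrow> complex" where
  "lagrange_interp \<Omega> \<T> p w =
     (THE v. v \<in> fe_space \<Omega> \<T> p \<and> (\<forall>K\<in>\<T>. \<forall>x\<in>lagrange_nodes p K \<inter> \<Omega>. v x = w x))"

definition time_node :: "real \<Rightarrow> nat \<Rightarrow> real" where
  "time_node \<tau> n = real n * \<tau>"

definition time_interval :: "real \<Rightarrow> nat \<Rightarrow> real set" where
  "time_interval \<tau> n = {time_node \<tau> (n - 1)..time_node \<tau> n}"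

text \<open>Legendre polynomials by Rodrigues' formula. The Gauss nodes are their roots, enumerated
  here in an arbitrary order.\<close>

definition legendre :: "nat \<Rightarrow> real poly" where
  "legendre k = smult (1 / (2 ^ k * fact k)) ((pderiv ^^ k) ([:-1, 0, 1:] ^ k))"

definition gauss_nodes :: "nat \<Rightarrow> (nat \<Rightarrow> real) \<Rightarrow> bool" where
  "gauss_nodes k c \<longleftrightarrow> bij_betw c {1..k} {x. poly (legendre k) x = 0}"

definition colloc_node :: "real \<Rightarrow> (nat \<Rightarrow> real) \<Rightarrow> nat \<Rightarrow> nat \<Rightarrow> real" where
  "colloc_node \<tau> c n j = time_node \<tau> (n - 1) + (1 + c j) * \<tau> / 2"

definition poly_tensor_on ::
  "real set \<Rightarrow> nat \<Rightarrow> ('a \<Rightarrow> complex) set \<Rightarrow> (real \<Rightarrow> 'a \<Rightarrow> complex) \<Rightarrow> bool" where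
  "poly_tensor_on I k S v \<longleftrightarrow>
     (\<exists>\<phi>. (\<forall>j\<le>k. \<phi> j \<in> S) \<and> (\<forall>t\<in>I. \<forall>x. v t x = (\<Sum>j\<le>k. of_real (t ^ j) * \<phi> j x)))"

text \<open>Time-dependent functions in the next two definitions are only constrained on
  \<open>[0, N \<tau>]\<close>. Continuity with values in \<^const>\<open>fe_space\<close> is with respect to the \<open>L\<^sup>2\<close> norm.\<close>

definition X_space ::
  "'a::euclidean_space set \<Rightarrow> 'a set set \<Rightarrow> nat \<Rightarrow> real \<Rightarrow> nat \<Rightarrow> nat \<Rightarrow> (real \<Rightarrow> 'a \<Rightarrow> complex) set" where
  "X_space \<Omega> \<T> p \<tau> N k =
     {v. (\<forall>t\<in>{0..time_node \<tau> N}. v t \<in> fe_space \<Omega> \<T> p \<and>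
            ((\<lambda>s. L2_norm \<Omega> (\<lambda>x. v s x - v t x)) \<longlongrightarrow> 0) (at t within {0..time_node \<tau> N})) \<and>
         (\<forall>n\<in>{1..N}. poly_tensor_on (time_interval \<tau> n) k (fe_space \<Omega> \<T> p) v)}"

definition Y_space :: "real \<Rightarrow> nat \<Rightarrow> nat \<Rightarrow> (real \<Rightarrow> real) set" where
  "Y_space \<tau> N k =
     {q. continuous_on {0..time_node \<tau> N} q \<and>
         (\<forall>n\<in>{1..N}. \<exists>P. degree P \<le> k \<and> (\<forall>t\<in>time_interval \<tau> n. q t = poly P t))}"

definition dt_fun :: "real \<Rightarrow> nat \<Rightarrow> (real \<Rightarrow> 'a \<Rightarrow> complex) \<Rightarrow> real \<Rightarrow> 'a \<Rightarrow> complex" where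
  "dt_fun \<tau> n u t x = vector_derivative (\<lambda>s. u s x) (at t within time_interval \<tau> n)"

definition dt_real :: "real \<Rightarrow> nat \<Rightarrow> (real \<Rightarrow> real) \<Rightarrow> real \<Rightarrow> real" where
  "dt_real \<tau> n r t = vector_derivative r (at t within time_interval \<tau> n)"

definition sav_radicand ::
  "'a::euclidean_space set \<Rightarrow> (real \<Rightarrow> real) \<Rightarrow> real \<Rightarrow> ('a \<Rightarrow> complex) \<Rightarrow> real" where
  "sav_radicand \<Omega> F c0 v = (LINT x:\<Omega>|lebesgue. 1/2 * F ((cmod (v x))\<^sup>2)) + c0"

definition sav_g ::
  "'a::euclidean_space set \<Rightarrow> (real \<Rightarrow> real) \<Rightarrow> (real \<Rightarrow> real) \<Rightarrow> real \<Rightarrow> ('a \<Rightarrow> complex) \<Rightarrow> 'a \<Rightarrow> real" where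
  "sav_g \<Omega> f F c0 v x = f ((cmod (v x))\<^sup>2) / sqrt (sav_radicand \<Omega> F c0 v)"

end

theory Submission
  imports Defs
begin

text \<open>
  On one time step the discrete solution is \<open>u = \<Sum>j\<le>k. t\<^sup>j \<phi>\<^sub>j\<close> with \<open>\<phi>\<^sub>j\<close> in the finite element
  space, and \<open>r\<close> is a polynomial of degree at most \<open>k\<close>. The mass \<open>\<parallel>u\<parallel>\<^sup>2\<close> and the energy
  \<open>\<parallel>\<nabla>u\<parallel>\<^sup>2/2 - r\<^sup>2\<close> are therefore real polynomials in \<open>t\<close> of degree at most \<open>2k\<close>
  (\<open>hermitian_form.energy_polynomial\<close>), with derivatives \<open>2 Re (\<partial>\<^sub>t u, u)\<close> and
  \<open>Re (\<nabla>\<partial>\<^sub>t u, \<nabla>u) - 2 r \<partial>\<^sub>t r\<close>.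

  Both derivatives vanish at the collocation nodes. Testing the scheme with \<open>u\<close> and taking
  imaginary parts kills the gradient term and the nonlinear term, which are real, and leaves
  \<open>Re (\<partial>\<^sub>t u, u) = 0\<close>. Testing it with \<open>\<partial>\<^sub>t u\<close>, which again lies in the finite element space, and taking
  real parts kills \<open>\<i>\<parallel>\<partial>\<^sub>t u\<parallel>\<^sup>2\<close>; the equation for \<open>r\<close> turns what is left into
  \<open>Re (\<nabla>u, \<nabla>\<partial>\<^sub>t u) = 2 r \<partial>\<^sub>t r\<close>.

  A polynomial of degree below \<open>2k\<close> that vanishes at the \<open>k\<close> Gauss nodes has integral zero: it is
  the Legendre polynomial of degree \<open>k\<close> times a cofactor of degree below \<open>k\<close>, to which the
  Legendre polynomial is orthogonal. So mass and energy agree at the two ends of each step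
  (\<open>poly_const_over_step_if_pderiv_zero_at_colloc_nodes\<close>), and induction over the steps finishes
  the proof.

  Two points of rigour remain. The Gauss nodes must lie in \<open>[-1, 1]\<close>, since only inside the time step
  is \<open>u\<close> the given polynomial (\<open>legendre_root_in_interval\<close>). And the \<open>L\<^sup>2\<close> and gradient
  products must be sesquilinear on the finite element space, which requires integrability and, as
  the derivatives are unspecified on the null set of cell boundaries, an argument that ignores that
  set (\<open>hermitian_form_L2\<close>, \<open>hermitian_form_grad\<close>).
\<close>

section \<open>Legendre polynomials and Gauss nodes\<close>

lemma power_dvd_iterated_pderiv:
  fixes p :: "real poly"
  assumes "m \<le> n"
  shows "p ^ (n - m) dvd (pderiv ^^ m) (p ^ n)"
  using assms
proof (induction m)
  case (Suc m)
  then obtain q where q: "(pderiv ^^ m) (p ^ n) = p ^ (n - m) * q"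
    by (auto elim: dvdE)
  have nm: "n - m = Suc (n - Suc m)"
    using Suc.prems by simp
  have "pderiv (p ^ (n - m) * q)
    = p ^ (n - Suc m) * (p * pderiv q + q * smult (of_nat (Suc (n - Suc m))) (pderiv p))"
    unfolding nm pderiv_mult pderiv_power_Suc by (simp add: algebra_simps)
  then show ?case
    using q by simp
qed simp

text \<open>Integrating \<open>w\<^sup>(\<^sup>k\<^sup>) q\<close> by parts \<open>k\<close> times produces no boundary terms and ends with the \<open>k\<close>-th
  derivative of \<open>q\<close>, which is zero. The vanishing of the integral from \<open>a\<close> to \<open>b\<close> is expressed by
  an antiderivative, so that the argument stays within polynomials.\<close>

lemma poly_integration_by_parts:
  fixes w q :: "real poly"
  assumes "degree q < k"
    and "\<And>m. m < k \<Longrightarrow> poly ((pderiv ^^ m) w) a = 0 \<and> poly ((pderiv ^^ m) w) b = 0"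
  shows "\<exists>A. pderiv A = (pderiv ^^ k) w * q \<and> poly A a = 0 \<and> poly A b = 0"
  using assms
proof (induction k arbitrary: q)
  case (Suc k)
  let ?D = "(pderiv ^^ k) w"
  have D: "poly ?D a = 0" "poly ?D b = 0"
    using Suc.prems(2) by auto
  have "\<exists>A. pderiv A = ?D * pderiv q \<and> poly A a = 0 \<and> poly A b = 0"
  proof (cases "degree q = 0")
    case True
    then have "pderiv q = 0"
      by (simp add: pderiv_eq_0_iff)
    then show ?thesis
      by (intro exI[of _ 0]) simp
  next
    case False
    then have "degree (pderiv q) < k"
      using Suc.prems(1) by (simp add: degree_pderiv)
    then show ?thesis
      using Suc.prems(2) by (intro Suc.IH) auto
  qed
  then obtain A where "pderiv A = ?D * pderiv q" "poly A a = 0" "poly A b = 0"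
    by blast
  \<comment> \<open>one integration by parts: \<open>(w\<^sup>(\<^sup>k\<^sup>) q)' = w\<^sup>(\<^sup>k\<^sup>+\<^sup>1\<^sup>) q + w\<^sup>(\<^sup>k\<^sup>) q'\<close>\<close>
  then show ?case
    using D by (intro exI[of _ "?D * q - A"]) (simp add: pderiv_diff pderiv_mult algebra_simps)
qed simp

lemma degree_iterated_pderiv:
  "degree ((pderiv ^^ m) p) = degree p - m" for p :: "real poly"
  by (induction m) (auto simp: degree_pderiv)

lemma degree_legendre: "degree (legendre k) = k"
  by (simp add: legendre_def degree_iterated_pderiv degree_power_eq)

text \<open>Orthogonality of the Legendre polynomial to all polynomials of lower degree on \<open>[-1, 1]\<close>: in
  Rodrigues' formula every derivative of \<open>(x\<^sup>2 - 1)\<^sup>k\<close> of order below \<open>k\<close> still contains the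
  factor \<open>x\<^sup>2 - 1\<close>.\<close>

lemma legendre_orthogonal:
  assumes "degree q < k"
  shows "\<exists>A. pderiv A = legendre k * q \<and> poly A (-1) = 0 \<and> poly A 1 = 0"
proof -
  let ?w = "[:-1, 0, 1:] :: real poly"
  have van: "poly ((pderiv ^^ m) (?w ^ k)) (-1) = 0 \<and> poly ((pderiv ^^ m) (?w ^ k)) 1 = 0"
    if "m < k" for m
  proof -
    have "?w dvd ?w ^ (k - m)"
      using that by (simp add: dvd_power)
    then have "?w dvd (pderiv ^^ m) (?w ^ k)"
      using power_dvd_iterated_pderiv[of m k ?w] that by (meson dvd_trans less_imp_le)
    then show ?thesis
      by (auto elim!: dvdE)
  qed
  obtain A where "pderiv A = (pderiv ^^ k) (?w ^ k) * q" "poly A (-1) = 0" "poly A 1 = 0"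
    using poly_integration_by_parts[OF assms van] by blast
  then show ?thesis
    by (intro exI[of _ "smult (1 / (2 ^ k * fact k)) A"]) (simp add: legendre_def pderiv_smult)
qed

lemma pderiv_pcompose_affine:
  "pderiv (p \<circ>\<^sub>p [:a, b:]) = smult b (pderiv p \<circ>\<^sub>p [:a, b:])" for p :: "real poly"
  by (simp add: pderiv_pcompose pderiv_pCons)

lemma iterated_pderiv_pcompose_affine:
  "(pderiv ^^ m) (p \<circ>\<^sub>p [:a, b:]) = smult (b ^ m) ((pderiv ^^ m) p \<circ>\<^sub>p [:a, b:])" for p :: "real poly"
  by (induction m) (simp_all add: pderiv_pcompose_affine pderiv_smult mult.commute)

lemma pcompose_power: "(p ^ m) \<circ>\<^sub>p q = (p \<circ>\<^sub>p q) ^ m" for p q :: "real poly"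
  by (induction m) (simp_all add: pcompose_mult pcompose_1)

lemma coeff_iterated_pderiv_nonneg:
  fixes p :: "real poly"
  assumes "\<And>i. 0 \<le> coeff p i"
  shows "0 \<le> coeff ((pderiv ^^ m) p) i"
  using assms by (induction m arbitrary: i) (simp_all add: coeff_pderiv)

lemma coeff_power_nonneg:
  fixes p :: "real poly"
  assumes "\<And>i. 0 \<le> coeff p i"
  shows "0 \<le> coeff (p ^ m) i"
  using assms by (induction m arbitrary: i) (auto simp: coeff_mult intro!: sum_nonneg)

lemma poly_pos_of_coeff_nonneg:
  fixes p :: "real poly"
  assumes "p \<noteq> 0" "\<And>i. 0 \<le> coeff p i" "0 < y"
  shows "0 < poly p y"
proof -
  have "0 < lead_coeff p * y ^ degree p"
    using assms by (metis leading_coeff_0_iff less_eq_real_def mult_pos_pos zero_less_power)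
  also have "\<dots> \<le> poly p y"
    unfolding poly_altdef using assms by (intro member_le_sum) auto
  finally show ?thesis .
qed

text \<open>The substitution \<open>x = s (1 + y)\<close> with \<open>s = \<plusminus>1\<close> turns \<open>(x\<^sup>2 - 1)\<^sup>k\<close> into \<open>(y\<^sup>2 + 2y)\<^sup>k\<close>, whose
  coefficients are nonnegative. The same then holds for its derivatives, so up to sign the Legendre
  polynomial is positive for \<open>y > 0\<close>, that is, for \<open>\<bar>x\<bar> > 1\<close>.\<close>

lemma legendre_root_in_interval:
  assumes "poly (legendre k) x = 0"
  shows "-1 \<le> x \<and> x \<le> 1"
proof (rule ccontr)
  assume out: "\<not> ?thesis"
  define s :: real where "s = sgn x"
  define y where "y = \<bar>x\<bar> - 1"
  have s: "s * s = 1" "s = 1 \<or> s = -1" and y: "0 < y" and x: "x = s + y * s"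
    using out by (auto simp: s_def y_def sgn_if)
  let ?w = "[:-1, 0, 1:] :: real poly"
  let ?z = "[:0, 2, 1:] :: real poly"
  have "?w \<circ>\<^sub>p [:s, s:] = ?z"
    using s(2) by (auto simp: pcompose_pCons)
  then have "(?w ^ k) \<circ>\<^sub>p [:s, s:] = ?z ^ k"
    by (simp add: pcompose_power)
  then have eq: "(pderiv ^^ k) (?z ^ k) = smult (s ^ k) ((pderiv ^^ k) (?w ^ k) \<circ>\<^sub>p [:s, s:])"
    using iterated_pderiv_pcompose_affine[of k "?w ^ k" s s] by simp
  have "0 \<le> coeff ?z i" for i
    by (cases i rule: nat.exhaust) (auto simp: coeff_pCons split: nat.split)
  then have nn: "0 \<le> coeff ((pderiv ^^ k) (?z ^ k)) i" for i
    by (intro coeff_iterated_pderiv_nonneg coeff_power_nonneg)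
  have nz: "(pderiv ^^ k) (?z ^ k) \<noteq> 0"
  proof (cases "k = 0")
    case False
    have "degree ((pderiv ^^ k) (?z ^ k)) = k"
      by (simp add: degree_iterated_pderiv degree_power_eq)
    then show ?thesis
      using False by auto
  qed simp
  have "0 < poly ((pderiv ^^ k) (?z ^ k)) y"
    using nz nn y by (rule poly_pos_of_coeff_nonneg)
  then have "0 < s ^ k * poly ((pderiv ^^ k) (?w ^ k)) x"
    unfolding eq by (simp add: poly_pcompose x)
  moreover have "poly ((pderiv ^^ k) (?w ^ k)) x = 0"
    using assms by (simp add: legendre_def)
  ultimately show False
    by simp
qed

lemma gauss_node_in_interval:
  assumes "gauss_nodes k c" "j \<in> {1..k}"
  shows "-1 \<le> c j" "c j \<le> 1"
proof -
  have "c j \<in> {x. poly (legendre k) x = 0}"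
    using assms by (auto simp: gauss_nodes_def dest: bij_betwE)
  then show "-1 \<le> c j" "c j \<le> 1"
    using legendre_root_in_interval by auto
qed

text \<open>The remainder modulo the Legendre polynomial has degree below \<open>k\<close> and \<open>k\<close> distinct zeros. That
  there are \<open>k\<close> of them is part of the assumption that \<open>c\<close> enumerates the roots bijectively.\<close>

lemma legendre_dvd_if_zero_at_gauss_nodes:
  assumes "gauss_nodes k c" "1 \<le> k" "\<And>j. j \<in> {1..k} \<Longrightarrow> poly Q (c j) = 0"
  shows "legendre k dvd Q"
proof (rule ccontr)
  let ?L = "legendre k"
  let ?R = "Q mod ?L"
  assume "\<not> ?L dvd Q"
  then have R: "?R \<noteq> 0"
    by (simp add: dvd_eq_mod_eq_0)
  have L: "?L \<noteq> 0"
    using degree_legendre[of k] assms(2) by auto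
  have roots: "c ` {1..k} = {x. poly ?L x = 0}" and inj: "inj_on c {1..k}"
    using assms(1) by (auto simp: gauss_nodes_def bij_betw_def)
  have "poly ?R (c j) = 0" if "j \<in> {1..k}" for j
  proof -
    have "poly ?L (c j) = 0"
      using roots that by blast
    then show ?thesis
      using assms(3)[OF that] poly_mod[of ?L "c j" Q] by simp
  qed
  then have "c ` {1..k} \<subseteq> {x. poly ?R x = 0}"
    by auto
  then have "card (c ` {1..k}) \<le> card {x. poly ?R x = 0}"
    by (intro card_mono) (auto simp: poly_roots_finite R)
  also have "\<dots> \<le> degree ?R"
    using R by (rule card_poly_roots_bound)
  also have "\<dots> < k"
    using degree_mod_less[OF L, of Q] R degree_legendre by auto
  finally show False
    using card_image[OF inj] by simp
qed

section \<open>Exactness of Gauss quadrature on a time step\<close>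

lemma colloc_node_in_time_interval:
  assumes "gauss_nodes k c" "j \<in> {1..k}" "1 \<le> n" "0 < \<tau>"
  shows "colloc_node \<tau> c n j \<in> time_interval \<tau> n"
proof -
  have "0 \<le> (1 + c j) * \<tau> / 2" "(1 + c j) * \<tau> / 2 \<le> \<tau>"
    using gauss_node_in_interval[OF assms(1,2)] assms(4) by auto
  then show ?thesis
    using assms(3) by (simp add: colloc_node_def time_interval_def time_node_def of_nat_diff algebra_simps)
qed

text \<open>The form of the exactness of Gauss quadrature that is used: \<open>pderiv P\<close> has degree at most
  \<open>2k - 1\<close> and vanishes at all quadrature nodes, so its integral over the time step is zero.\<close>

lemma poly_const_over_step_if_pderiv_zero_at_colloc_nodes:
  assumes "gauss_nodes k c" "1 \<le> k" "1 \<le> n" "degree P \<le> 2 * k"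
    and "\<And>j. j \<in> {1..k} \<Longrightarrow> poly (pderiv P) (colloc_node \<tau> c n j) = 0"
  shows "poly P (time_node \<tau> n) = poly P (time_node \<tau> (n - 1))"
proof -
  \<comment> \<open>the affine map from \<open>[-1, 1]\<close> onto the time step\<close>
  define l where "l = [:time_node \<tau> (n - 1) + \<tau> / 2, \<tau> / 2:]"
  have l: "poly l (c j) = colloc_node \<tau> c n j" "poly l 1 = time_node \<tau> n"
     "poly l (-1) = time_node \<tau> (n - 1)" for j
    using assms(3) by (simp_all add: l_def colloc_node_def time_node_def of_nat_diff field_simps)
  define R where "R = P \<circ>\<^sub>p l"
  have "poly (pderiv R) (c j) = 0" if "j \<in> {1..k}" for j
    unfolding R_def l_def pderiv_pcompose_affine
    using assms(5)[OF that] l(1) by (simp add: poly_pcompose l_def)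
  then have "legendre k dvd pderiv R"
    using legendre_dvd_if_zero_at_gauss_nodes[OF assms(1,2)] by blast
  then obtain q where q: "pderiv R = legendre k * q"
    by (auto elim: dvdE)
  have "degree q < k"
  proof (cases "q = 0")
    case False
    have "legendre k \<noteq> 0"
      using degree_legendre[of k] assms(2) by auto
    then have "degree (pderiv R) = k + degree q"
      using False by (simp add: q degree_mult_eq degree_legendre)
    moreover have "degree (pderiv R) \<le> 2 * k - 1"
    proof -
      have "degree R \<le> degree P"
        unfolding R_def l_def degree_pcompose by (auto split: if_splits)
      then show ?thesis
        using assms(4) by (simp add: degree_pderiv)
    qed
    ultimately show ?thesis
      using assms(2) by linarith
  qed (use assms(2) in auto)
  then obtain A where A: "pderiv A = pderiv R" "poly A (-1) = 0" "poly A 1 = 0"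
    using legendre_orthogonal[of q k] q by auto
  have "pderiv (R - A) = 0"
    by (simp add: pderiv_diff A)
  then obtain d where "R - A = [:d:]"
    by (metis degree_eq_zeroE pderiv_eq_0_iff)
  then have "R = A + [:d:]"
    by (simp add: algebra_simps)
  then have "poly R 1 = poly R (-1)"
    by (simp add: A)
  then show ?thesis
    by (simp add: R_def poly_pcompose l)
qed

section \<open>Hermitian forms along polynomials in time\<close>

text \<open>The abstract setting shared by the \<open>L\<^sup>2\<close> product and the gradient product: a Hermitian form on a
  real vector space of complex-valued functions. The scalars are real because the coefficients \<open>t\<^sup>j\<close> are.\<close>

locale hermitian_form =
  fixes S :: "('a \<Rightarrow> complex) set" and B :: "('a \<Rightarrow> complex) \<Rightarrow> ('a \<Rightarrow> complex) \<Rightarrow> complex"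
  assumes zero_closed: "(\<lambda>x. 0) \<in> S"
    and add_closed: "v \<in> S \<Longrightarrow> w \<in> S \<Longrightarrow> (\<lambda>x. v x + w x) \<in> S"
    and scale_closed: "v \<in> S \<Longrightarrow> (\<lambda>x. of_real a * v x) \<in> S"
    and add_left: "v \<in> S \<Longrightarrow> w \<in> S \<Longrightarrow> z \<in> S \<Longrightarrow> B (\<lambda>x. v x + w x) z = B v z + B w z"
    and scale_left: "v \<in> S \<Longrightarrow> z \<in> S \<Longrightarrow> B (\<lambda>x. of_real a * v x) z = of_real a * B v z"
    and conj_sym: "v \<in> S \<Longrightarrow> w \<in> S \<Longrightarrow> B w v = cnj (B v w)"
begin

lemma lincomb_closed:
  assumes "finite I" "\<And>i. i \<in> I \<Longrightarrow> \<phi> i \<in> S"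
  shows "(\<lambda>x. \<Sum>i\<in>I. of_real (a i) * \<phi> i x) \<in> S"
  using assms
proof (induction I)
  case (insert i I)
  then show ?case
    using add_closed[OF scale_closed[of "\<phi> i" "a i"]] by simp
qed (simp add: zero_closed)

lemma lincomb_left:
  assumes "finite I" "\<And>i. i \<in> I \<Longrightarrow> \<phi> i \<in> S" "z \<in> S"
  shows "B (\<lambda>x. \<Sum>i\<in>I. of_real (a i) * \<phi> i x) z = (\<Sum>i\<in>I. of_real (a i) * B (\<phi> i) z)"
  using assms
proof (induction I)
  case empty
  then show ?case
    using scale_left[OF zero_closed, of z 0] by simp
next
  case (insert i I)
  then show ?case
    by (simp add: add_left scale_left scale_closed lincomb_closed)
qed

lemma Re_sym: "v \<in> S \<Longrightarrow> w \<in> S \<Longrightarrow> Re (B w v) = Re (B v w)"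
  using conj_sym[of v w] by simp

lemma Im_self: "v \<in> S \<Longrightarrow> Im (B v v) = 0"
  using conj_sym[of v v] by (simp add: complex_eq_iff)

lemma Re_lincomb:
  assumes "finite I" "\<And>i. i \<in> I \<Longrightarrow> \<phi> i \<in> S"
  shows "Re (B (\<lambda>x. \<Sum>i\<in>I. of_real (a i) * \<phi> i x) (\<lambda>x. \<Sum>j\<in>I. of_real (b j) * \<phi> j x))
    = (\<Sum>i\<in>I. \<Sum>j\<in>I. a i * b j * Re (B (\<phi> i) (\<phi> j)))"
proof -
  let ?z = "\<lambda>x. \<Sum>j\<in>I. of_real (b j) * \<phi> j x"
  have z: "?z \<in> S"
    using assms by (rule lincomb_closed)
  have "Re (B (\<phi> i) ?z) = (\<Sum>j\<in>I. b j * Re (B (\<phi> i) (\<phi> j)))" if "i \<in> I" for i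
  proof -
    have "Re (B (\<phi> i) ?z) = Re (B ?z (\<phi> i))"
      using Re_sym z assms(2) that by blast
    also have "\<dots> = (\<Sum>j\<in>I. b j * Re (B (\<phi> j) (\<phi> i)))"
      using assms that by (simp add: lincomb_left)
    also have "\<dots> = (\<Sum>j\<in>I. b j * Re (B (\<phi> i) (\<phi> j)))"
      using assms that by (intro sum.cong refl) (metis Re_sym)
    finally show ?thesis .
  qed
  then show ?thesis
    using assms z by (simp add: lincomb_left sum_distrib_left mult.assoc)
qed

text \<open>For a function of time with values in \<open>S\<close> that is polynomial in time, the quadratic form
  evaluated along it is a polynomial as well, and the product rule combines with the Hermitian
  symmetry of the form to give \<open>2 Re B (\<partial>\<^sub>t U, U)\<close> as its derivative. It can be integrated by
  Gauss quadrature like any real polynomial.\<close>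

lemma energy_polynomial:
  assumes "\<And>j. j \<le> k \<Longrightarrow> \<phi> j \<in> S"
  defines "U \<equiv> \<lambda>t x. \<Sum>j\<le>k. of_real (t ^ j) * \<phi> j x"
    and "U' \<equiv> \<lambda>t x. \<Sum>j\<le>k. of_real (real j * t ^ (j - 1)) * \<phi> j x"
  shows "\<exists>P. degree P \<le> 2 * k \<and>
    (\<forall>t. poly P t = Re (B (U t) (U t)) \<and> poly (pderiv P) t = 2 * Re (B (U' t) (U t)))"
proof -
  define M where "M i j = Re (B (\<phi> i) (\<phi> j))" for i j
  have sym: "M i j = M j i" if "i \<le> k" "j \<le> k" for i j
    using assms(1) that by (simp add: M_def Re_sym)
  define P where "P = (\<Sum>i\<le>k. \<Sum>j\<le>k. smult (M i j) (monom 1 i * monom 1 j))"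
  have "degree P \<le> 2 * k"
    unfolding P_def
    by (intro degree_sum_le finite_atMost order_trans[OF degree_smult_le])
       (auto simp: mult_monom degree_monom_eq)
  moreover have "poly P t = Re (B (U t) (U t))" for t
    unfolding U_def P_def using assms(1)
    by (subst Re_lincomb) (auto simp: poly_sum poly_monom M_def mult_ac)
  moreover have "poly (pderiv P) t = 2 * Re (B (U' t) (U t))" for t
  proof -
    let ?d = "\<lambda>i. real i * t ^ (i - 1)"
    have "poly (pderiv P) t
      = (\<Sum>i\<le>k. \<Sum>j\<le>k. M i j * ?d i * t ^ j) + (\<Sum>i\<le>k. \<Sum>j\<le>k. M i j * ?d j * t ^ i)"
      unfolding P_def
      by (simp add: higher_pderiv_sum[of 1, simplified] pderiv_smult pderiv_mult pderiv_monom poly_sum poly_monom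
          sum.distrib algebra_simps)
    also have "(\<Sum>i\<le>k. \<Sum>j\<le>k. M i j * ?d j * t ^ i) = (\<Sum>i\<le>k. \<Sum>j\<le>k. M i j * ?d i * t ^ j)"
      by (subst sum.swap) (auto intro!: sum.cong simp: sym)
    also have "(\<Sum>i\<le>k. \<Sum>j\<le>k. M i j * ?d i * t ^ j) = Re (B (U' t) (U t))"
      unfolding U_def U'_def using assms(1)
      by (subst Re_lincomb) (auto simp: M_def mult_ac)
    finally show ?thesis
      by simp
  qed
  ultimately show ?thesis
    by blast
qed

end

section \<open>Integrability of piecewise continuous functions\<close>

text \<open>Both finite element functions and their partial derivatives have this property. On each closed
  cell the continuous representative \<open>G\<close> is bounded, and only its values in the interior matter,
  because the derivative of a finite element function is unspecified on cell boundaries.\<close>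

definition piecewise_continuous :: "'a::euclidean_space set set \<Rightarrow> ('a \<Rightarrow> complex) \<Rightarrow> bool" where
  "piecewise_continuous \<T> f \<longleftrightarrow> (\<forall>K\<in>\<T>. \<exists>G. continuous_on K G \<and> (\<forall>x\<in>interior K. f x = G x))"

lemma piecewise_continuous_mult_cnj:
  assumes "piecewise_continuous \<T> f" "piecewise_continuous \<T> g"
  shows "piecewise_continuous \<T> (\<lambda>x. f x * cnj (g x))"
  unfolding piecewise_continuous_def
proof
  fix K assume "K \<in> \<T>"
  then obtain F G where "continuous_on K F" "\<forall>x\<in>interior K. f x = F x"
    "continuous_on K G" "\<forall>x\<in>interior K. g x = G x"
    using assms unfolding piecewise_continuous_def by blast
  then show "\<exists>H. continuous_on K H \<and> (\<forall>x\<in>interior K. f x * cnj (g x) = H x)"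
    by (intro exI[of _ "\<lambda>x. F x * cnj (G x)"]) (auto intro!: continuous_intros)
qed

lemma mesh_cell:
  assumes "domain_triangulation \<Omega> \<T>" "K \<in> \<T>"
  shows "compact K" "convex K"
proof -
  obtain n where n: "n simplex K"
    using assms by (auto simp: domain_triangulation_def triangulation_def)
  then show "convex K"
    by (rule convex_simplex)
  show "compact K"
    using n by (rule compact_simplex)
qed

lemma finite_mesh: "domain_triangulation \<Omega> \<T> \<Longrightarrow> finite \<T>"
  by (simp add: domain_triangulation_def triangulation_def)

lemma negligible_mesh_skeleton:
  assumes "domain_triangulation \<Omega> \<T>"
  shows "negligible (\<Union>K\<in>\<T>. frontier K)"
  using assms mesh_cell(2) by (auto intro!: negligible_Union negligible_convex_frontier simp: finite_mesh)

lemma mesh_interior_cover: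
  assumes "domain_triangulation \<Omega> \<T>" "x \<in> \<Omega>" "x \<notin> (\<Union>K\<in>\<T>. frontier K)"
  obtains K where "K \<in> \<T>" "x \<in> interior K"
proof -
  have "x \<in> \<Union>\<T>"
    using assms(1,2) closure_subset by (auto simp: domain_triangulation_def)
  then show ?thesis
    using that assms(3) closure_subset by (fastforce simp: frontier_def)
qed

text \<open>Each cell is compact, which gives integrability over its interior; the interiors cover \<open>\<Omega>\<close> up
  to the cell boundaries, which are negligible because the cells are convex.\<close>

lemma piecewise_continuous_integrable:
  assumes mesh: "domain_triangulation \<Omega> \<T>" and "open \<Omega>" and f: "piecewise_continuous \<T> f"
  shows "f absolutely_integrable_on \<Omega>"
proof -
  let ?U = "\<Union>K\<in>\<T>. interior K"
  have "f absolutely_integrable_on interior K" if K: "K \<in> \<T>" for K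
  proof -
    obtain G where G: "continuous_on K G" "\<forall>x\<in>interior K. f x = G x"
      using f K by (auto simp: piecewise_continuous_def)
    have "integrable lborel (\<lambda>x. indicator K x *\<^sub>R G x)"
      using G(1) mesh_cell(1)[OF mesh K] by (intro borel_integrable_compact)
    then have "G absolutely_integrable_on K"
      unfolding set_integrable_def
      using integrable_completion[OF borel_measurable_integrable] by blast
    then have "G absolutely_integrable_on interior K"
      by (rule set_integrable_subset) (auto simp: interior_subset)
    then show ?thesis
      using G(2) by (subst set_integrable_cong[OF refl refl]) auto
  qed
  then have "f absolutely_integrable_on ?U"
    by (intro set_integrable_UN) (auto simp: finite_mesh[OF mesh])
  then have "f absolutely_integrable_on ?U \<inter> \<Omega>"
    by (rule set_integrable_subset)
       (auto simp: \<open>open \<Omega>\<close> intro!: sets_completionI_sets borel_open open_Int open_UN)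
  then show ?thesis
  proof (rule absolutely_integrable_spike_set)
    show "negligible {x \<in> \<Omega> - ?U \<inter> \<Omega>. f x \<noteq> 0}"
      by (rule negligible_subset[OF negligible_mesh_skeleton[OF mesh]])
         (auto elim: mesh_interior_cover[OF mesh])
  qed auto
qed

lemma set_integral_spike:
  fixes f g :: "'a::euclidean_space \<Rightarrow> complex"
  assumes "f absolutely_integrable_on S" "negligible Z" "\<And>x. x \<in> S - Z \<Longrightarrow> g x = f x"
  shows "(LINT x:S|lebesgue. g x) = (LINT x:S|lebesgue. f x)"
proof -
  have "g absolutely_integrable_on S"
    using assms by (rule absolutely_integrable_spike)
  then show ?thesis
    using assms integral_spike[of Z S f g] by (simp add: set_lebesgue_integral_eq_integral)
qed

lemma L2_inner_commute: "L2_inner \<Omega> w v = cnj (L2_inner \<Omega> v w)"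
  unfolding L2_inner_def set_lebesgue_integral_def Bochner_Integration.integral_cnj[symmetric]
  by (simp add: mult.commute)

lemma L2_inner_self: "L2_inner \<Omega> v v = of_real (LINT x:\<Omega>|lebesgue. (cmod (v x))\<^sup>2)"
  unfolding L2_inner_def complex_norm_square[symmetric] of_real_power[symmetric]
  by (rule set_integral_complex_of_real)

lemma L2_inner_self_nonneg: "0 \<le> Re (L2_inner \<Omega> v v)"
  by (simp add: L2_inner_self set_lebesgue_integral_def)

text \<open>In the next two lemmas the identity between the functions is required only off the cell boundaries,
  since that is where partial derivatives are linear in the function.\<close>

context
  fixes \<Omega> :: "'a::euclidean_space set" and \<T> :: "'a set set"
  assumes mesh: "domain_triangulation \<Omega> \<T>" and open_domain: "open \<Omega>"
begin

lemma L2_inner_add_left_ae: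
  assumes "piecewise_continuous \<T> f" "piecewise_continuous \<T> g" "piecewise_continuous \<T> z"
    and "\<And>x. x \<in> \<Omega> - (\<Union>K\<in>\<T>. frontier K) \<Longrightarrow> e x = f x + g x"
  shows "L2_inner \<Omega> e z = L2_inner \<Omega> f z + L2_inner \<Omega> g z"
proof -
  have int: "(\<lambda>x. f x * cnj (z x)) absolutely_integrable_on \<Omega>"
    "(\<lambda>x. g x * cnj (z x)) absolutely_integrable_on \<Omega>"
    using assms(1-3)
    by (auto intro!: piecewise_continuous_integrable[OF mesh open_domain] piecewise_continuous_mult_cnj)
  have "L2_inner \<Omega> e z = (LINT x:\<Omega>|lebesgue. f x * cnj (z x) + g x * cnj (z x))"
    unfolding L2_inner_def using assms(4) int
    by (intro set_integral_spike[OF _ negligible_mesh_skeleton[OF mesh]])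
       (auto simp: ring_distribs)
  then show ?thesis
    using int by (simp add: L2_inner_def)
qed

lemma L2_inner_scale_left_ae:
  assumes "piecewise_continuous \<T> f" "piecewise_continuous \<T> z"
    and "\<And>x. x \<in> \<Omega> - (\<Union>K\<in>\<T>. frontier K) \<Longrightarrow> e x = c * f x"
  shows "L2_inner \<Omega> e z = c * L2_inner \<Omega> f z"
proof -
  have int: "(\<lambda>x. f x * cnj (z x)) absolutely_integrable_on \<Omega>"
    using assms(1-2)
    by (auto intro!: piecewise_continuous_integrable[OF mesh open_domain] piecewise_continuous_mult_cnj)
  have "L2_inner \<Omega> e z = (LINT x:\<Omega>|lebesgue. c * (f x * cnj (z x)))"
    unfolding L2_inner_def using assms(3) int
    by (intro set_integral_spike[OF _ negligible_mesh_skeleton[OF mesh]]) auto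
  then show ?thesis
    by (simp add: L2_inner_def)
qed

end

section \<open>Sesquilinearity on the finite element space\<close>

text \<open>The polynomial that represents \<open>v\<close> on \<open>K\<close> is defined on the whole space. Its directional
  derivatives are continuous up to and across the boundary of \<open>K\<close>, where \<open>v\<close> itself may fail to
  be differentiable.\<close>

lemma polynomial_on_smooth_extension:
  assumes "polynomial_on p K v"
  shows "\<exists>q D. (\<forall>x\<in>K. v x = q x) \<and> (\<forall>x. (q has_derivative D x) (at x)) \<and>
    (\<forall>b. continuous_on UNIV (\<lambda>x. D x b))"
proof -
  obtain c where c: "\<forall>x\<in>K. v x = (\<Sum>\<alpha>\<in>multi_indices p. c \<alpha> * of_real (\<Prod>b\<in>Basis. (x \<bullet> b) ^ \<alpha> b))"
    using assms by (auto simp: polynomial_on_def)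
  let ?q = "\<lambda>x. \<Sum>\<alpha>\<in>multi_indices p. c \<alpha> * of_real (\<Prod>b\<in>Basis. (x \<bullet> b) ^ \<alpha> b)"
  let ?D = "\<lambda>x y. \<Sum>\<alpha>\<in>multi_indices p. c \<alpha> * complex_of_real (\<Sum>b\<in>Basis.
      (of_nat (\<alpha> b) * (y \<bullet> b) * (x \<bullet> b) ^ (\<alpha> b - 1)) * (\<Prod>j\<in>Basis - {b}. (x \<bullet> j) ^ \<alpha> j))"
  have "(?q has_derivative ?D x) (at x)" for x
    by (intro has_derivative_sum has_derivative_mult_right has_derivative_of_real
        has_derivative_prod has_derivative_power has_derivative_inner_left has_derivative_ident)
  moreover have "continuous_on UNIV (\<lambda>x. ?D x b)" for b
    by (intro continuous_intros)
  ultimately show ?thesis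
    using c by (intro exI[of _ ?q] exI[of _ ?D]) auto
qed

lemma fe_space_interior_derivative:
  assumes "v \<in> fe_space \<Omega> \<T> p" "K \<in> \<T>"
  shows "\<exists>D. (\<forall>x\<in>interior K. (v has_derivative D x) (at x)) \<and> (\<forall>b. continuous_on UNIV (\<lambda>x. D x b))"
proof -
  have "polynomial_on p K v"
    using assms by (auto simp: fe_space_def)
  then obtain q D where q: "\<And>x. x \<in> K \<Longrightarrow> v x = q x" "\<And>x. (q has_derivative D x) (at x)"
    and D: "\<And>b. continuous_on UNIV (\<lambda>x. D x b)"
    using polynomial_on_smooth_extension by blast
  have "(v has_derivative D x) (at x)" if "x \<in> interior K" for x
    using q(2) open_interior that
    by (rule has_derivative_transform_within_open) (metis q(1) interior_subset subsetD)
  then show ?thesis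
    using D by blast
qed

lemma piecewise_continuous_fe:
  assumes "v \<in> fe_space \<Omega> \<T> p" "domain_triangulation \<Omega> \<T>"
  shows "piecewise_continuous \<T> v"
  unfolding piecewise_continuous_def
proof
  fix K assume "K \<in> \<T>"
  then have "K \<subseteq> closure \<Omega>"
    using assms(2) by (auto simp: domain_triangulation_def)
  then show "\<exists>G. continuous_on K G \<and> (\<forall>x\<in>interior K. v x = G x)"
    using assms(1) by (intro exI[of _ v]) (auto simp: fe_space_def intro: continuous_on_subset)
qed

lemma piecewise_continuous_partial_deriv:
  assumes "v \<in> fe_space \<Omega> \<T> p"
  shows "piecewise_continuous \<T> (partial_deriv b v)"
  unfolding piecewise_continuous_def
proof
  fix K assume "K \<in> \<T>"
  with assms obtain D where D: "\<And>x. x \<in> interior K \<Longrightarrow> (v has_derivative D x) (at x)"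
    "\<And>b. continuous_on UNIV (\<lambda>x. D x b)"
    using fe_space_interior_derivative by blast
  have "partial_deriv b v x = D x b" if "x \<in> interior K" for x
    using frechet_derivative_at[OF D(1)[OF that]] by (simp add: partial_deriv_def)
  then show "\<exists>G. continuous_on K G \<and> (\<forall>x\<in>interior K. partial_deriv b v x = G x)"
    using D(2) continuous_on_subset by blast
qed

lemma fe_space_differentiable:
  assumes "domain_triangulation \<Omega> \<T>" "v \<in> fe_space \<Omega> \<T> p" "x \<in> \<Omega> - (\<Union>K\<in>\<T>. frontier K)"
  shows "(v has_derivative frechet_derivative v (at x)) (at x)"
proof -
  obtain K where "K \<in> \<T>" "x \<in> interior K"
    using mesh_interior_cover[OF assms(1)] assms(3) by blast
  then show ?thesis
    using fe_space_interior_derivative[OF assms(2)] frechet_derivative_at by metis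
qed

lemma polynomial_on_add:
  assumes "polynomial_on p K v" "polynomial_on p K w"
  shows "polynomial_on p K (\<lambda>x. v x + w x)"
proof -
  obtain c d where "\<forall>x\<in>K. v x = (\<Sum>\<alpha>\<in>multi_indices p. c \<alpha> * of_real (\<Prod>b\<in>Basis. (x \<bullet> b) ^ \<alpha> b))"
    "\<forall>x\<in>K. w x = (\<Sum>\<alpha>\<in>multi_indices p. d \<alpha> * of_real (\<Prod>b\<in>Basis. (x \<bullet> b) ^ \<alpha> b))"
    using assms by (auto simp: polynomial_on_def)
  then show ?thesis
    unfolding polynomial_on_def
    by (intro exI[of _ "\<lambda>\<alpha>. c \<alpha> + d \<alpha>"]) (simp add: sum.distrib ring_distribs)
qed

lemma polynomial_on_scale:
  assumes "polynomial_on p K v"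
  shows "polynomial_on p K (\<lambda>x. a * v x)"
proof -
  obtain c where "\<forall>x\<in>K. v x = (\<Sum>\<alpha>\<in>multi_indices p. c \<alpha> * of_real (\<Prod>b\<in>Basis. (x \<bullet> b) ^ \<alpha> b))"
    using assms by (auto simp: polynomial_on_def)
  then show ?thesis
    unfolding polynomial_on_def
    by (intro exI[of _ "\<lambda>\<alpha>. a * c \<alpha>"]) (simp add: sum_distrib_left mult.assoc)
qed

lemma fe_space_zero: "(\<lambda>x. 0) \<in> fe_space \<Omega> \<T> p"
  by (auto simp: fe_space_def polynomial_on_def intro!: exI[of _ "\<lambda>_. 0"])

lemma fe_space_add:
  "v \<in> fe_space \<Omega> \<T> p \<Longrightarrow> w \<in> fe_space \<Omega> \<T> p \<Longrightarrow> (\<lambda>x. v x + w x) \<in> fe_space \<Omega> \<T> p"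
  by (auto simp: fe_space_def intro!: continuous_intros polynomial_on_add)

lemma fe_space_scale: "v \<in> fe_space \<Omega> \<T> p \<Longrightarrow> (\<lambda>x. a * v x) \<in> fe_space \<Omega> \<T> p"
  by (auto simp: fe_space_def intro!: continuous_intros polynomial_on_scale)

lemma hermitian_form_L2:
  assumes "domain_triangulation \<Omega> \<T>" "open \<Omega>"
  shows "hermitian_form (fe_space \<Omega> \<T> p) (L2_inner \<Omega>)"
  using assms
  by unfold_locales
     (auto intro: fe_space_zero fe_space_add fe_space_scale L2_inner_commute
        piecewise_continuous_fe L2_inner_add_left_ae L2_inner_scale_left_ae)

lemma hermitian_form_grad:
  assumes mesh: "domain_triangulation \<Omega> \<T>" and "open \<Omega>"
  shows "hermitian_form (fe_space \<Omega> \<T> p) (grad_inner \<Omega>)"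
proof (unfold_locales, goal_cases)
  case (4 v w z)
  have "partial_deriv b (\<lambda>x. v x + w x) x = partial_deriv b v x + partial_deriv b w x"
    if "x \<in> \<Omega> - (\<Union>K\<in>\<T>. frontier K)" for b x
    using frechet_derivative_at[OF has_derivative_add[OF fe_space_differentiable[OF mesh 4(1) that]
        fe_space_differentiable[OF mesh 4(2) that]]]
    by (simp add: partial_deriv_def fun_eq_iff)
  then show ?case
    unfolding grad_inner_def sum.distrib[symmetric] using 4
    by (intro sum.cong refl L2_inner_add_left_ae[OF assms] piecewise_continuous_partial_deriv) auto
next
  case (5 v z a)
  have "partial_deriv b (\<lambda>x. of_real a * v x) x = of_real a * partial_deriv b v x"
    if "x \<in> \<Omega> - (\<Union>K\<in>\<T>. frontier K)" for b x
    using frechet_derivative_at[OF has_derivative_mult_right[OF fe_space_differentiable[OF mesh 5(1) that], of "of_real a"]]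
    by (simp add: partial_deriv_def fun_eq_iff)
  then show ?case
    unfolding grad_inner_def sum_distrib_left using 5
    by (intro sum.cong refl L2_inner_scale_left_ae[OF assms] piecewise_continuous_partial_deriv) auto
next
  case (6 v w)
  show ?case
    unfolding grad_inner_def cnj_sum by (intro sum.cong refl L2_inner_commute)
qed (auto intro: fe_space_zero fe_space_add fe_space_scale)

section \<open>Conservation of mass and energy\<close>

lemma time_interval_nondegenerate:
  "0 < \<tau> \<Longrightarrow> 1 \<le> n \<Longrightarrow> time_node \<tau> (n - 1) < time_node \<tau> n"
  by (simp add: time_node_def)

lemma dt_real_poly:
  assumes "0 < \<tau>" "1 \<le> n" "t \<in> time_interval \<tau> n" "\<And>s. s \<in> time_interval \<tau> n \<Longrightarrow> q s = poly P s"
  shows "dt_real \<tau> n q t = poly (pderiv P) t"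
proof -
  have "(poly P has_vector_derivative poly (pderiv P) t) (at t within time_interval \<tau> n)"
    using has_field_derivative_at_within[OF poly_DERIV]
    by (simp flip: has_real_derivative_iff_has_vector_derivative)
  then have "(q has_vector_derivative poly (pderiv P) t) (at t within time_interval \<tau> n)"
    using assms(3,4) by (rule has_vector_derivative_transform[rotated 2])
  then show ?thesis
    unfolding dt_real_def time_interval_def
    using assms(3) time_interval_nondegenerate[OF assms(1,2)]
    by (intro vector_derivative_within_closed_interval) (auto simp: time_interval_def)
qed

lemma dt_fun_tensor:
  assumes "0 < \<tau>" "1 \<le> n" "t \<in> time_interval \<tau> n"
    and "\<And>s x. s \<in> time_interval \<tau> n \<Longrightarrow> u s x = (\<Sum>j\<le>k. of_real (s ^ j) * \<phi> j x)"
  shows "dt_fun \<tau> n u t = (\<lambda>x. \<Sum>j\<le>k. of_real (real j * t ^ (j - 1)) * \<phi> j x)"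
proof
  fix x
  let ?d = "\<Sum>j\<le>k. of_real (real j * t ^ (j - 1)) * \<phi> j x"
  have "((\<lambda>s. of_real (s ^ j) * \<phi> j x) has_vector_derivative of_real (real j * t ^ (j - 1)) * \<phi> j x)
      (at t within time_interval \<tau> n)" for j
    by (intro has_vector_derivative_mult_left has_vector_derivative_of_real)
       (auto intro!: derivative_eq_intros simp flip: has_real_derivative_iff_has_vector_derivative)
  then have "((\<lambda>s. \<Sum>j\<le>k. of_real (s ^ j) * \<phi> j x) has_vector_derivative ?d) (at t within time_interval \<tau> n)"
    by (intro has_vector_derivative_sum)
  then have "((\<lambda>s. u s x) has_vector_derivative ?d) (at t within time_interval \<tau> n)"
    using assms(3,4) by (rule has_vector_derivative_transform[rotated 2])
  then show "dt_fun \<tau> n u t x = ?d"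
    unfolding dt_fun_def time_interval_def
    using assms(3) time_interval_nondegenerate[OF assms(1,2)]
    by (intro vector_derivative_within_closed_interval) (auto simp: time_interval_def)
qed

text \<open>The integrand is the real function \<open>a w \<bar>v\<bar>\<^sup>2\<close>. This covers the nonlinear term tested with the
  solution, also when that integrand fails to be integrable, as the integral is then zero.\<close>

lemma Im_L2_inner_real_weight: "Im (L2_inner \<Omega> (\<lambda>x. of_real a * of_real (w x) * v x) v) = 0"
proof -
  have "L2_inner \<Omega> (\<lambda>x. of_real a * of_real (w x) * v x) v
    = (LINT x:\<Omega>|lebesgue. complex_of_real (a * w x * (cmod (v x))\<^sup>2))"
    unfolding L2_inner_def
    by (simp only: of_real_mult complex_norm_square mult.assoc)
  then show ?thesis
    by (simp only: set_integral_complex_of_real Im_complex_of_real)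
qed

text \<open>The value zero of the integral of a nonintegrable function makes this hold for all \<open>f\<close>, \<open>v\<close> and
  \<open>w\<close>, in particular for the nonlinear term with the constant factor \<open>r(t)\<close>.\<close>

lemma L2_inner_scale_left: "L2_inner \<Omega> (\<lambda>x. a * f x * v x) w = a * L2_inner \<Omega> (\<lambda>x. f x * v x) w"
  by (simp add: L2_inner_def mult.assoc)

lemma norms_as_forms:
  "(L2_norm \<Omega> v)\<^sup>2 = Re (L2_inner \<Omega> v v)" "(grad_norm \<Omega> v)\<^sup>2 = Re (grad_inner \<Omega> v v)"
  by (simp_all add: L2_norm_def grad_norm_def grad_inner_def L2_inner_self_nonneg sum_nonneg)

text \<open>Here \<open>w t\<close> stands for the weight \<open>g(u(t))\<close>. It is real, which makes the mass constant, and it is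
  the same in both equations of the scheme, which makes the nonlinear terms cancel in the energy.\<close>

lemma collocation_step_conserves:
  fixes u :: "real \<Rightarrow> 'a::euclidean_space \<Rightarrow> complex"
  assumes mesh: "domain_triangulation \<Omega> \<T>" and "open \<Omega>"
    and k: "1 \<le> k" and gauss: "gauss_nodes k c" and "0 < \<tau>" and n: "1 \<le> n"
    and u: "poly_tensor_on (time_interval \<tau> n) k (fe_space \<Omega> \<T> p) u"
    and R: "degree R \<le> k" "\<And>t. t \<in> time_interval \<tau> n \<Longrightarrow> r t = poly R t"
    and scheme_u: "\<And>j v. j \<in> {1..k} \<Longrightarrow> v \<in> fe_space \<Omega> \<T> p \<Longrightarrow>
      (let t = colloc_node \<tau> c n j in
        \<i> * L2_inner \<Omega> (dt_fun \<tau> n u t) v + grad_inner \<Omega> (u t) v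
          - L2_inner \<Omega> (\<lambda>x. of_real (r t) * of_real (w t x) * u t x) v = 0)"
    and scheme_r: "\<And>j. j \<in> {1..k} \<Longrightarrow>
      (let t = colloc_node \<tau> c n j in
        dt_real \<tau> n r t = 1/2 * Re (L2_inner \<Omega> (\<lambda>x. of_real (w t x) * u t x) (dt_fun \<tau> n u t)))"
  defines "t0 \<equiv> time_node \<tau> (n - 1)" and "t1 \<equiv> time_node \<tau> n"
  shows "(L2_norm \<Omega> (u t1))\<^sup>2 = (L2_norm \<Omega> (u t0))\<^sup>2"
    and "1/2 * (grad_norm \<Omega> (u t1))\<^sup>2 - (r t1)\<^sup>2 = 1/2 * (grad_norm \<Omega> (u t0))\<^sup>2 - (r t0)\<^sup>2"
proof -
  let ?V = "fe_space \<Omega> \<T> p"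
  interpret L2: hermitian_form ?V "L2_inner \<Omega>"
    using mesh \<open>open \<Omega>\<close> by (rule hermitian_form_L2)
  interpret grad: hermitian_form ?V "grad_inner \<Omega>"
    using mesh \<open>open \<Omega>\<close> by (rule hermitian_form_grad)
  obtain \<phi> where \<phi>: "\<And>j. j \<le> k \<Longrightarrow> \<phi> j \<in> ?V"
    and u_eq: "\<And>t x. t \<in> time_interval \<tau> n \<Longrightarrow> u t x = (\<Sum>j\<le>k. of_real (t ^ j) * \<phi> j x)"
    using u unfolding poly_tensor_on_def by blast
  define U where "U t x = (\<Sum>j\<le>k. of_real (t ^ j) * \<phi> j x)" for t x
  define U' where "U' t x = (\<Sum>j\<le>k. of_real (real j * t ^ (j - 1)) * \<phi> j x)" for t x
  have u_U: "u t = U t" "dt_fun \<tau> n u t = U' t" if "t \<in> time_interval \<tau> n" for t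
  proof -
    show "u t = U t"
      using u_eq[OF that] by (simp add: U_def fun_eq_iff)
    show "dt_fun \<tau> n u t = U' t"
      unfolding U'_def using \<open>0 < \<tau>\<close> n that u_eq by (rule dt_fun_tensor)
  qed
  have UV: "U t \<in> ?V" "U' t \<in> ?V" for t
    unfolding U_def U'_def by (rule L2.lincomb_closed; simp add: \<phi>)+
  have ends: "t0 \<in> time_interval \<tau> n" "t1 \<in> time_interval \<tau> n"
    using time_interval_nondegenerate[OF \<open>0 < \<tau>\<close> n] by (auto simp: t0_def t1_def time_interval_def)
  have node: "colloc_node \<tau> c n j \<in> time_interval \<tau> n" if "j \<in> {1..k}" for j
    using colloc_node_in_time_interval[OF gauss that n \<open>0 < \<tau>\<close>] .
  have scheme: "\<i> * L2_inner \<Omega> (U' t) v + grad_inner \<Omega> (U t) v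
      = L2_inner \<Omega> (\<lambda>x. of_real (r t) * of_real (w t x) * U t x) v"
    if "j \<in> {1..k}" "v \<in> ?V" "t = colloc_node \<tau> c n j" for j v t
    using scheme_u[OF that(1,2)] u_U[OF node[OF that(1)]] that(3) by (simp add: Let_def)

  obtain M where M: "degree M \<le> 2 * k" "\<And>t. poly M t = Re (L2_inner \<Omega> (U t) (U t))"
    "\<And>t. poly (pderiv M) t = 2 * Re (L2_inner \<Omega> (U' t) (U t))"
    using L2.energy_polynomial[of k \<phi>] \<phi> unfolding U_def U'_def by blast
  \<comment> \<open>mass: test with \<open>u\<close> and compare imaginary parts\<close>
  have "poly (pderiv M) (colloc_node \<tau> c n j) = 0" if "j \<in> {1..k}" for j
  proof -
    let ?t = "colloc_node \<tau> c n j"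
    have "Im (\<i> * L2_inner \<Omega> (U' ?t) (U ?t) + grad_inner \<Omega> (U ?t) (U ?t)) = 0"
      unfolding scheme[OF that UV(1) refl] by (rule Im_L2_inner_real_weight)
    then show ?thesis
      using grad.Im_self[OF UV(1)] by (simp add: M)
  qed
  then have "poly M t1 = poly M t0"
    unfolding t0_def t1_def
    by (rule poly_const_over_step_if_pderiv_zero_at_colloc_nodes[OF gauss k n M(1)])
  then show "(L2_norm \<Omega> (u t1))\<^sup>2 = (L2_norm \<Omega> (u t0))\<^sup>2"
    by (simp add: norms_as_forms M(2) u_U(1) ends)

  obtain G where G: "degree G \<le> 2 * k" "\<And>t. poly G t = Re (grad_inner \<Omega> (U t) (U t))"
    "\<And>t. poly (pderiv G) t = 2 * Re (grad_inner \<Omega> (U' t) (U t))"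
    using grad.energy_polynomial[of k \<phi>] \<phi> unfolding U_def U'_def by blast
  define E where "E = smult (1/2) G - R\<^sup>2"
  have "degree (R\<^sup>2) \<le> 2 * k"
    using degree_power_le[of R 2] R(1) by linarith
  then have "degree E \<le> 2 * k"
    unfolding E_def using G(1) by (intro degree_diff_le) simp_all
  \<comment> \<open>energy: test with \<open>\<partial>\<^sub>t u\<close> and compare real parts\<close>
  moreover have "poly (pderiv E) (colloc_node \<tau> c n j) = 0" if j: "j \<in> {1..k}" for j
  proof -
    let ?t = "colloc_node \<tau> c n j"
    let ?N = "L2_inner \<Omega> (\<lambda>x. of_real (w ?t x) * U ?t x) (U' ?t)"
    have "Re (grad_inner \<Omega> (U' ?t) (U ?t)) = Re (grad_inner \<Omega> (U ?t) (U' ?t))"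
      using grad.Re_sym UV by blast
    also have "\<dots> = Re (\<i> * L2_inner \<Omega> (U' ?t) (U' ?t) + grad_inner \<Omega> (U ?t) (U' ?t))"
      using L2.Im_self[OF UV(2)] by simp
    also have "\<dots> = r ?t * Re ?N"
      unfolding scheme[OF j UV(2) refl] L2_inner_scale_left by simp
    also have "Re ?N = 2 * poly (pderiv R) ?t"
      using scheme_r[OF j] u_U[OF node[OF j]] dt_real_poly[OF \<open>0 < \<tau>\<close> n node[OF j] R(2)]
      by (simp add: Let_def)
    finally show ?thesis
      using R(2)[OF node[OF j]]
      by (simp add: E_def pderiv_diff pderiv_smult pderiv_mult power2_eq_square G(3))
  qed
  ultimately have "poly E t1 = poly E t0"
    unfolding t0_def t1_def
    by (rule poly_const_over_step_if_pderiv_zero_at_colloc_nodes[OF gauss k n])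
  then show "1/2 * (grad_norm \<Omega> (u t1))\<^sup>2 - (r t1)\<^sup>2 = 1/2 * (grad_norm \<Omega> (u t0))\<^sup>2 - (r t0)\<^sup>2"
    by (simp add: E_def norms_as_forms G(2) u_U(1) R(2) ends)
qed

theorem theorem3p1:
  fixes \<Omega> :: "'a::euclidean_space set"
    and \<T> :: "'a set set"
    and h \<sigma> \<kappa> T \<tau> c0 :: real
    and p k N :: nat
    and c :: "nat \<Rightarrow> real"
    and f F :: "real \<Rightarrow> real"
    and u0 :: "'a \<Rightarrow> complex"
    and u :: "real \<Rightarrow> 'a \<Rightarrow> complex"
    and r :: "real \<Rightarrow> real"
  assumes domain: "polyhedral_domain \<Omega>"
    and mesh: "domain_triangulation \<Omega> \<T>" "shape_regular \<sigma> \<T>" "quasi_uniform \<kappa> \<T>"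
    and h: "h = mesh_size \<T>" "0 < h" "h < 1"
    and p: "1 \<le> p"
    and time: "0 < T" "1 \<le> N" "\<tau> = T / real N" "\<tau> < 1"
    and k: "1 \<le> k"
    and gauss: "gauss_nodes k c"
    and f: "\<And>s. 0 \<le> s \<Longrightarrow> (F has_real_derivative f s) (at s within {0..})"
    and c0: "0 < c0" "0 < sav_radicand \<Omega> F c0 u0"
      "\<And>n j. n \<in> {1..N} \<Longrightarrow> j \<in> {1..k} \<Longrightarrow> 0 < sav_radicand \<Omega> F c0 (u (colloc_node \<tau> c n j))"
    and spaces: "u \<in> X_space \<Omega> \<T> p \<tau> N k" "r \<in> Y_space \<tau> N k"
    and init: "u 0 = lagrange_interp \<Omega> \<T> p u0" "r 0 = sqrt (sav_radicand \<Omega> F c0 u0)"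
    and scheme_u: "\<And>n j v. n \<in> {1..N} \<Longrightarrow> j \<in> {1..k} \<Longrightarrow> v \<in> fe_space \<Omega> \<T> p \<Longrightarrow>
      (let t = colloc_node \<tau> c n j in
        \<i> * L2_inner \<Omega> (dt_fun \<tau> n u t) v + grad_inner \<Omega> (u t) v
          - L2_inner \<Omega> (\<lambda>x. of_real (r t) * of_real (sav_g \<Omega> f F c0 (u t) x) * u t x) v = 0)"
    and scheme_r: "\<And>n j. n \<in> {1..N} \<Longrightarrow> j \<in> {1..k} \<Longrightarrow>
      (let t = colloc_node \<tau> c n j in
        dt_real \<tau> n r t =
          1/2 * Re (L2_inner \<Omega> (\<lambda>x. of_real (sav_g \<Omega> f F c0 (u t) x) * u t x) (dt_fun \<tau> n u t)))"
  shows "\<forall>n\<in>{1..N}.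
      1/2 * (L2_norm \<Omega> (u (time_node \<tau> n)))\<^sup>2 = 1/2 * (L2_norm \<Omega> (u (time_node \<tau> 0)))\<^sup>2 \<and>
      1/2 * (grad_norm \<Omega> (u (time_node \<tau> n)))\<^sup>2 - \<bar>r (time_node \<tau> n)\<bar>\<^sup>2 + c0
        = 1/2 * (grad_norm \<Omega> (u (time_node \<tau> 0)))\<^sup>2 - \<bar>r (time_node \<tau> 0)\<bar>\<^sup>2 + c0"
proof -
  let ?t = "time_node \<tau>"
  let ?E = "\<lambda>t. 1/2 * (grad_norm \<Omega> (u t))\<^sup>2 - (r t)\<^sup>2"
  have "open \<Omega>"
    using domain by (simp add: polyhedral_domain_def)
  have "0 < \<tau>"
    using time by simp
  have step: "(L2_norm \<Omega> (u (?t n)))\<^sup>2 = (L2_norm \<Omega> (u (?t (n - 1))))\<^sup>2 \<and> ?E (?t n) = ?E (?t (n - 1))"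
    if n: "n \<in> {1..N}" for n
  proof -
    have n1: "1 \<le> n"
      using n by simp
    have u: "poly_tensor_on (time_interval \<tau> n) k (fe_space \<Omega> \<T> p) u"
      using spaces(1) n by (simp add: X_space_def)
    obtain R where R: "degree R \<le> k" "\<And>t. t \<in> time_interval \<tau> n \<Longrightarrow> r t = poly R t"
      using spaces(2) n unfolding Y_space_def by blast
    note conserves = collocation_step_conserves[where u = u and r = r and w = "\<lambda>t. sav_g \<Omega> f F c0 (u t)",
        OF mesh(1) \<open>open \<Omega>\<close> k gauss \<open>0 < \<tau>\<close> n1 u R scheme_u[OF n] scheme_r[OF n]]
    show ?thesis
      using conserves by blast
  qed
  have conserved: "(L2_norm \<Omega> (u (?t n)))\<^sup>2 = (L2_norm \<Omega> (u (?t 0)))\<^sup>2 \<and> ?E (?t n) = ?E (?t 0)" if "n \<le> N" for n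
    using that
  proof (induction n)
    case (Suc n)
    then show ?case
      using step[of "Suc n"] by simp
  qed simp
  show ?thesis
  proof
    fix n assume "n \<in> {1..N}"
    then show "1/2 * (L2_norm \<Omega> (u (?t n)))\<^sup>2 = 1/2 * (L2_norm \<Omega> (u (?t 0)))\<^sup>2 \<and>
      1/2 * (grad_norm \<Omega> (u (?t n)))\<^sup>2 - \<bar>r (?t n)\<bar>\<^sup>2 + c0
        = 1/2 * (grad_norm \<Omega> (u (?t 0)))\<^sup>2 - \<bar>r (?t 0)\<bar>\<^sup>2 + c0"
      using conserved[of n] by simp
  qed
qed

end
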